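(* Let $P_{tT}$ ($0\le t\le T<\infty$) be an admissible, arbitrage-free family of discount bond price processes with absolute volatility $\Sigma_{tT}$, short rate $r_t$ and market price of risk $\lambda_t$, driven by a multidimensional Brownian motion $W_t$ as described in the context. Put $\rho_t(x)=-\partial_x P_{t,t+x}$ and $\omega_{tx}=-\partial_x\Sigma_{t,t+x}$ for $x\ge 0$. Then for each $t$ the random function $\rho_t(\cdot)$ is a probability density on $[0,\infty)$, and for each $x$ the process $\rho_t(x)$ satisfies $$\mathrm{d}\rho_t(x)=\bigl(r_t\rho_t(x)+\partial_x\rho_t(x)\bigr)\,\mathrm{d}t+\omega_{tx}\cdot\bigl(\mathrm{d}W_t+\lambda_t\,\mathrm{d}t\bigr),$$ subject to the constraints, valid for all $t$, $$r_t+\int_0^\infty\partial_x\rho_t(x)\,\mathrm{d}x=0,\qquad \int_0^\infty\omega_{tx}\,\mathrm{d}x=0 .$$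
   Context: Discount bonds: $P_{tT}$ is the value at time $t$ of a bond paying one unit at time $T$. On a filtered probability space generated by a (vector) Brownian motion $W_t$, the bond prices have dynamics $\mathrm{d}P_{tT}=\mu_{tT}\,\mathrm{d}t+\Sigma_{tT}\cdot\mathrm{d}W_t$, where the adapted absolute drift $\mu_{tT}$ (scalar) and absolute volatility $\Sigma_{tT}$ (vector) are smooth in $T$, and $\cdot$ is the inner product of vectors. Admissible: for each $t$, $P_{tt}=1$, $0<P_{tT}\le1$, $P_{tT}$ is smooth in $T$ with $\partial_TP_{tT}<0$, and $P_{tT}\to0$ as $T\to\infty$. Short rate: $r_t=-\partial_TP_{tT}|_{T=t}$. Arbitrage-free: there is an adapted vector process $\lambda_t$ (the market price of risk), not depending on $T$, with $\mu_{tT}=r_tP_{tT}+\Sigma_{tT}\cdot\lambda_t$ for all $t\le T$. Standing assumptions: $\Sigma_{tt}=0$; $\Sigma_{t,t+x}\to0$ and $\rho_t(x)\to0$ as $x\to\infty$; and sufficiently strong technical conditions hold that the instantaneous forward rate processes are semimartingales, that $P_{t,t+x}$ is a semimartingale in $t$ with $\mathrm{d}(P_{t,t+x})=\mathrm{d}P_{tT}|_{T=t+x}+\partial_xP_{t,t+x}\,\mathrm{d}t$, and that one may differentiate its stochastic differential in $x$ under the integral signs. *)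

theory Defs
  imports "HOL-Probability.Probability"
begin

text \<open>
  Times are real numbers, and a process is a function of type \<open>real \<Rightarrow> 'w \<Rightarrow> 'a\<close> whose values are
  relevant only on a time set \<open>I\<close>, which is always \<open>{0..T}\<close> or \<open>{0..}\<close>.
  The libraries contain no stochastic integration, so Brownian motion, the Ito integral,
  stochastic differentials and semimartingales are defined here.
  Processes are identified up to indistinguishability; this is harmless as the probability
  space is taken complete and the filtration contains the null sets.
\<close>

subsection \<open>Brownian motion and its filtration\<close>

definition brownian_filtration ::
    "'w measure \<Rightarrow> (real \<Rightarrow> 'w \<Rightarrow> 'v::euclidean_space) \<Rightarrow> real \<Rightarrow> 'w measure" where
  "brownian_filtration M W t =
     sigma (space M)
       ({W s -` B \<inter> space M | s B. 0 \<le> s \<and> s \<le> t \<and> B \<in> sets borel} \<union> null_sets M)"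

text \<open>The coordinates of an increment over \<open>[s,t]\<close> are independent and normal with mean \<open>0\<close> and
  variance \<open>t - s\<close>.\<close>

definition brownian_motion ::
    "'w measure \<Rightarrow> (real \<Rightarrow> 'w \<Rightarrow> 'v::euclidean_space) \<Rightarrow> bool" where
  "brownian_motion M W \<longleftrightarrow>
     prob_space M \<and>
     (\<forall>t\<ge>0. W t \<in> borel_measurable M) \<and>
     (AE w in M. W 0 w = 0) \<and>
     (AE w in M. continuous_on {0..} (\<lambda>t. W t w)) \<and>
     (\<forall>s t. 0 \<le> s \<longrightarrow> s < t \<longrightarrow>
        distributed M lborel (\<lambda>w. W t w - W s w)
          (\<lambda>v. ennreal (\<Prod>e\<in>Basis. normal_density 0 (sqrt (t - s)) (v \<bullet> e))) \<and>
        prob_space.indep_set M (sets (brownian_filtration M W s))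
          {(\<lambda>w. W t w - W s w) -` B \<inter> space M | B. B \<in> sets borel})"

subsection \<open>Measurability of processes\<close>

definition adapted_on ::
    "(real \<Rightarrow> 'w measure) \<Rightarrow> real set \<Rightarrow> (real \<Rightarrow> 'w \<Rightarrow> 'a::topological_space) \<Rightarrow> bool" where
  "adapted_on F I H \<longleftrightarrow> (\<forall>t\<in>I. H t \<in> borel_measurable (F t))"

definition progressive_on ::
    "'w measure \<Rightarrow> (real \<Rightarrow> 'w measure) \<Rightarrow> real set \<Rightarrow>
     (real \<Rightarrow> 'w \<Rightarrow> 'a::topological_space) \<Rightarrow> bool" where
  "progressive_on M F I H \<longleftrightarrow>
     adapted_on F I H \<and>
     (\<exists>H'. (\<forall>t\<in>I. (\<lambda>(s, w). H' s w) \<in>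
              borel_measurable (restrict_space borel {0..t} \<Otimes>\<^sub>M F t)) \<and>
           (AE w in M. \<forall>t\<in>I. H t w = H' t w))"

definition converges_in_probability ::
    "'w measure \<Rightarrow> (nat \<Rightarrow> 'w \<Rightarrow> real) \<Rightarrow> ('w \<Rightarrow> real) \<Rightarrow> bool" where
  "converges_in_probability M X Y \<longleftrightarrow>
     (\<forall>n. X n \<in> borel_measurable M) \<and> Y \<in> borel_measurable M \<and>
     (\<forall>\<epsilon>>0. (\<lambda>n. measure M {w \<in> space M. \<epsilon> < \<bar>X n w - Y w\<bar>}) \<longlonglongrightarrow> 0)"

subsection \<open>The Ito integral\<close>

text \<open>Simple processes \<open>\<Sum>i<n. \<xi>\<^sub>i 1\<^bsub>(\<tau>\<^sub>i, \<tau>\<^sub>i\<^sub>+\<^sub>1]\<^esub>\<close>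
  with deterministic times and bounded coefficients known at the left end points.\<close>

definition simple_integrand ::
    "'w measure \<Rightarrow> (real \<Rightarrow> 'w measure) \<Rightarrow> nat \<Rightarrow> (nat \<Rightarrow> real) \<Rightarrow>
     (nat \<Rightarrow> 'w \<Rightarrow> 'v::euclidean_space) \<Rightarrow> bool" where
  "simple_integrand M F n \<tau> \<xi> \<longleftrightarrow>
     0 \<le> \<tau> 0 \<and> (\<forall>i<n. \<tau> i \<le> \<tau> (Suc i)) \<and>
     (\<forall>i<n. \<xi> i \<in> borel_measurable (F (\<tau> i))) \<and>
     (\<exists>C. \<forall>i<n. \<forall>w\<in>space M. norm (\<xi> i w) \<le> C)"

definition simple_process ::
    "nat \<Rightarrow> (nat \<Rightarrow> real) \<Rightarrow> (nat \<Rightarrow> 'w \<Rightarrow> 'v::euclidean_space) \<Rightarrow> real \<Rightarrow> 'w \<Rightarrow> 'v" where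
  "simple_process n \<tau> \<xi> t w = (\<Sum>i<n. indicator {\<tau> i<..\<tau> (Suc i)} t *\<^sub>R \<xi> i w)"

definition simple_ito_integral ::
    "(real \<Rightarrow> 'w \<Rightarrow> 'v::euclidean_space) \<Rightarrow> nat \<Rightarrow> (nat \<Rightarrow> real) \<Rightarrow> (nat \<Rightarrow> 'w \<Rightarrow> 'v) \<Rightarrow>
     real \<Rightarrow> 'w \<Rightarrow> real" where
  "simple_ito_integral W n \<tau> \<xi> t w =
     (\<Sum>i<n. \<xi> i w \<bullet> (W (min t (\<tau> (Suc i))) w - W (min t (\<tau> i)) w))"

text \<open>\<open>has_ito_integral M W I H J\<close>: the process \<open>J\<close> is a continuous version of
  \<open>\<integral>\<^sub>0\<^sup>t H\<^sub>s \<cdot> dW\<^sub>s\<close>, \<open>t \<in> I\<close>, for a progressive \<open>H\<close> with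
  \<open>\<integral>\<^sub>0\<^sup>t |H\<^sub>s|\<^sup>2 ds < \<infinity>\<close> almost surely.\<close>

definition has_ito_integral ::
    "'w measure \<Rightarrow> (real \<Rightarrow> 'w \<Rightarrow> 'v::euclidean_space) \<Rightarrow> real set \<Rightarrow>
     (real \<Rightarrow> 'w \<Rightarrow> 'v) \<Rightarrow> (real \<Rightarrow> 'w \<Rightarrow> real) \<Rightarrow> bool" where
  "has_ito_integral M W I H J \<longleftrightarrow>
     progressive_on M (brownian_filtration M W) I H \<and>
     (AE w in M. \<forall>t\<in>I. set_integrable lborel {0..t} (\<lambda>s. (norm (H s w))\<^sup>2)) \<and>
     adapted_on (brownian_filtration M W) I J \<and>
     (AE w in M. continuous_on I (\<lambda>t. J t w)) \<and>
     (\<exists>n \<tau> \<xi>.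
        (\<forall>k::nat. simple_integrand M (brownian_filtration M W) (n k) (\<tau> k) (\<xi> k)) \<and>
        (\<forall>t\<in>I.
           converges_in_probability M
             (\<lambda>k w. LBINT s:{0..t}. (norm (simple_process (n k) (\<tau> k) (\<xi> k) s w - H s w))\<^sup>2)
             (\<lambda>w. 0) \<and>
           converges_in_probability M
             (\<lambda>k. simple_ito_integral W (n k) (\<tau> k) (\<xi> k) t) (J t)))"

subsection \<open>Stochastic differentials\<close>

text \<open>\<open>ito_decomposition M W I X a b J\<close>:
  \<open>X\<^sub>t = X\<^sub>0 + \<integral>\<^sub>0\<^sup>t a\<^sub>s ds + J\<^sub>t\<close> with \<open>J\<^sub>t = \<integral>\<^sub>0\<^sup>t b\<^sub>s \<cdot> dW\<^sub>s\<close>.\<close>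

definition ito_decomposition ::
    "'w measure \<Rightarrow> (real \<Rightarrow> 'w \<Rightarrow> 'v::euclidean_space) \<Rightarrow> real set \<Rightarrow> (real \<Rightarrow> 'w \<Rightarrow> real) \<Rightarrow>
     (real \<Rightarrow> 'w \<Rightarrow> real) \<Rightarrow> (real \<Rightarrow> 'w \<Rightarrow> 'v) \<Rightarrow> (real \<Rightarrow> 'w \<Rightarrow> real) \<Rightarrow> bool" where
  "ito_decomposition M W I X a b J \<longleftrightarrow>
     X 0 \<in> borel_measurable (brownian_filtration M W 0) \<and>
     progressive_on M (brownian_filtration M W) I a \<and>
     (AE w in M. \<forall>t\<in>I. set_integrable lborel {0..t} (\<lambda>s. a s w)) \<and>
     has_ito_integral M W I b J \<and>
     (AE w in M. \<forall>t\<in>I. X t w = X 0 w + (LBINT s:{0..t}. a s w) + J t w)"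

text \<open>\<open>dX\<^sub>t = a\<^sub>t dt + b\<^sub>t \<cdot> dW\<^sub>t\<close> for \<open>t \<in> I\<close>\<close>

definition has_stochastic_differential ::
    "'w measure \<Rightarrow> (real \<Rightarrow> 'w \<Rightarrow> 'v::euclidean_space) \<Rightarrow> real set \<Rightarrow> (real \<Rightarrow> 'w \<Rightarrow> real) \<Rightarrow>
     (real \<Rightarrow> 'w \<Rightarrow> real) \<Rightarrow> (real \<Rightarrow> 'w \<Rightarrow> 'v) \<Rightarrow> bool" where
  "has_stochastic_differential M W I X a b \<longleftrightarrow> (\<exists>J. ito_decomposition M W I X a b J)"

text \<open>The derivative in the parameter \<open>x \<ge> 0\<close>, one-sided at \<open>x = 0\<close>\<close>

definition dx :: "(real \<Rightarrow> 'a::real_normed_vector) \<Rightarrow> real \<Rightarrow> 'a" where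
  "dx f x = vector_derivative f (at x within {0..})"

text \<open>For a family of processes \<open>X t x w\<close> with parameter \<open>x \<ge> 0\<close> and
  \<open>d X\<^sub>t(x) = a\<^sub>t(x) dt + b\<^sub>t(x) \<cdot> dW\<^sub>t\<close>, this says that both integrals
  can be differentiated in \<open>x\<close> under the integral sign. An Ito integral is determined, for each
  \<open>x\<close>, only up to a null set; hence the claim is that suitable versions \<open>J\<close> of the integrals of
  \<open>b(x)\<close> are differentiable in \<open>x\<close> and that their derivatives \<open>J'\<close> are versions of the
  integrals of \<open>\<partial>\<^sub>x b(x)\<close>.\<close>

definition differentiable_under_integrals ::
    "'w measure \<Rightarrow> (real \<Rightarrow> 'w \<Rightarrow> 'v::euclidean_space) \<Rightarrow> (real \<Rightarrow> real \<Rightarrow> 'w \<Rightarrow> real) \<Rightarrow>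
     (real \<Rightarrow> real \<Rightarrow> 'w \<Rightarrow> real) \<Rightarrow> (real \<Rightarrow> real \<Rightarrow> 'w \<Rightarrow> 'v) \<Rightarrow> bool" where
  "differentiable_under_integrals M W X a b \<longleftrightarrow>
     (\<forall>x\<ge>0. progressive_on M (brownian_filtration M W) {0..} (\<lambda>t w. dx (\<lambda>y. a t y w) x)) \<and>
     (AE w in M. \<forall>t\<ge>0. \<forall>x\<ge>0.
        set_integrable lborel {0..t} (\<lambda>s. a s x w) \<and>
        set_integrable lborel {0..t} (\<lambda>s. dx (\<lambda>y. a s y w) x) \<and>
        ((\<lambda>y. LBINT s:{0..t}. a s y w) has_real_derivative
           (LBINT s:{0..t}. dx (\<lambda>y. a s y w) x)) (at x within {0..})) \<and>
     (\<exists>J J'.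
        (\<forall>x\<ge>0. ito_decomposition M W {0..}
           (\<lambda>t. X t x) (\<lambda>t. a t x) (\<lambda>t. b t x) (\<lambda>t. J t x)) \<and>
        (\<forall>x\<ge>0. has_ito_integral M W {0..}
           (\<lambda>t w. dx (\<lambda>y. b t y w) x) (\<lambda>t. J' t x)) \<and>
        (AE w in M. \<forall>t\<ge>0. \<forall>x\<ge>0.
           ((\<lambda>y. J t y w) has_real_derivative J' t x w) (at x within {0..})))"

subsection \<open>Semimartingales\<close>

definition cadlag_on :: "real set \<Rightarrow> (real \<Rightarrow> real) \<Rightarrow> bool" where
  "cadlag_on I f \<longleftrightarrow>
     (\<forall>t\<in>I. (f \<longlongrightarrow> f t) (at t within I \<inter> {t<..}) \<and>
             (\<exists>l. (f \<longlongrightarrow> l) (at t within I \<inter> {..<t})))"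

definition finite_variation_on :: "real set \<Rightarrow> (real \<Rightarrow> real) \<Rightarrow> bool" where
  "finite_variation_on I f \<longleftrightarrow>
     (\<forall>t\<in>I. \<exists>K. \<forall>n p. mono p \<longrightarrow> (\<forall>i::nat. p i \<in> {0..t}) \<longrightarrow>
        (\<Sum>i<n. \<bar>f (p (Suc i)) - f (p i)\<bar>) \<le> K)"

definition martingale_on ::
    "'w measure \<Rightarrow> (real \<Rightarrow> 'w measure) \<Rightarrow> real set \<Rightarrow> (real \<Rightarrow> 'w \<Rightarrow> real) \<Rightarrow> bool" where
  "martingale_on M F I N \<longleftrightarrow>
     adapted_on F I N \<and> (\<forall>t\<in>I. integrable M (N t)) \<and>
     (\<forall>s\<in>I. \<forall>t\<in>I. s \<le> t \<longrightarrow> (AE w in M. real_cond_exp M (F s) (N t) w = N s w))"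

definition local_martingale_on ::
    "'w measure \<Rightarrow> (real \<Rightarrow> 'w measure) \<Rightarrow> real set \<Rightarrow> (real \<Rightarrow> 'w \<Rightarrow> real) \<Rightarrow> bool" where
  "local_martingale_on M F I N \<longleftrightarrow>
     adapted_on F I N \<and> (AE w in M. cadlag_on I (\<lambda>t. N t w)) \<and>
     (\<exists>\<tau>. (\<forall>n::nat. stopping_time F (\<tau> n) \<and> (\<forall>w. 0 \<le> \<tau> n w) \<and>
             martingale_on M F I (\<lambda>t w. N (min t (\<tau> n w)) w - N 0 w)) \<and>
          (AE w in M. incseq (\<lambda>n. \<tau> n w)) \<and>
          (AE w in M. \<forall>t\<in>I. \<forall>\<^sub>F n in sequentially. t \<le> \<tau> n w))"

definition semimartingale_on ::
    "'w measure \<Rightarrow> (real \<Rightarrow> 'w measure) \<Rightarrow> real set \<Rightarrow> (real \<Rightarrow> 'w \<Rightarrow> real) \<Rightarrow> bool" where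
  "semimartingale_on M F I X \<longleftrightarrow>
     (\<exists>N A. local_martingale_on M F I N \<and>
        adapted_on F I A \<and>
        (AE w in M. cadlag_on I (\<lambda>t. A t w) \<and> finite_variation_on I (\<lambda>t. A t w)) \<and>
        (AE w in M. \<forall>t\<in>I. X t w = N t w + A t w))"

subsection \<open>Discount bonds\<close>

text \<open>In \<open>P t T w\<close> the current time is \<open>t\<close> and the maturity is \<open>T\<close>; only \<open>0 \<le> t \<le> T\<close> matters,
  so derivatives in \<open>T\<close> are taken within \<open>{t..}\<close>.\<close>

definition smooth_from :: "real \<Rightarrow> (real \<Rightarrow> 'a::real_normed_vector) \<Rightarrow> bool" where
  "smooth_from a f \<longleftrightarrow>
     (\<exists>D. (\<forall>T\<ge>a. D 0 T = f T) \<and>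
        (\<forall>k::nat. \<forall>T\<ge>a. (D k has_vector_derivative D (Suc k) T) (at T within {a..})))"

definition bond_dynamics ::
    "'w measure \<Rightarrow> (real \<Rightarrow> 'w \<Rightarrow> 'v::euclidean_space) \<Rightarrow> (real \<Rightarrow> real \<Rightarrow> 'w \<Rightarrow> real) \<Rightarrow>
     (real \<Rightarrow> real \<Rightarrow> 'w \<Rightarrow> real) \<Rightarrow> (real \<Rightarrow> real \<Rightarrow> 'w \<Rightarrow> 'v) \<Rightarrow> bool" where
  "bond_dynamics M W P drift vol \<longleftrightarrow>
     (\<forall>T\<ge>0. has_stochastic_differential M W {0..T}
        (\<lambda>t. P t T) (\<lambda>t. drift t T) (\<lambda>t. vol t T)) \<and>
     (AE w in M. \<forall>t\<ge>0. smooth_from t (\<lambda>T. drift t T w) \<and> smooth_from t (\<lambda>T. vol t T w))"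

definition admissible :: "'w measure \<Rightarrow> (real \<Rightarrow> real \<Rightarrow> 'w \<Rightarrow> real) \<Rightarrow> bool" where
  "admissible M P \<longleftrightarrow>
     (AE w in M. \<forall>t\<ge>0.
        P t t w = 1 \<and>
        (\<forall>T\<ge>t. 0 < P t T w \<and> P t T w \<le> 1) \<and>
        smooth_from t (\<lambda>T. P t T w) \<and>
        (\<forall>T\<ge>t. vector_derivative (\<lambda>S. P t S w) (at T within {t..}) < 0) \<and>
        ((\<lambda>T. P t T w) \<longlongrightarrow> 0) at_top)"

definition short_rate :: "(real \<Rightarrow> real \<Rightarrow> 'w \<Rightarrow> real) \<Rightarrow> real \<Rightarrow> 'w \<Rightarrow> real" where
  "short_rate P t w = - vector_derivative (\<lambda>T. P t T w) (at t within {t..})"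

definition forward_rate :: "(real \<Rightarrow> real \<Rightarrow> 'w \<Rightarrow> real) \<Rightarrow> real \<Rightarrow> real \<Rightarrow> 'w \<Rightarrow> real" where
  "forward_rate P t T w = - vector_derivative (\<lambda>S. ln (P t S w)) (at T within {t..})"

definition market_price_of_risk ::
    "'w measure \<Rightarrow> (real \<Rightarrow> 'w \<Rightarrow> 'v::euclidean_space) \<Rightarrow> (real \<Rightarrow> real \<Rightarrow> 'w \<Rightarrow> real) \<Rightarrow>
     (real \<Rightarrow> real \<Rightarrow> 'w \<Rightarrow> real) \<Rightarrow> (real \<Rightarrow> real \<Rightarrow> 'w \<Rightarrow> 'v) \<Rightarrow> (real \<Rightarrow> 'w \<Rightarrow> 'v) \<Rightarrow> bool" where
  "market_price_of_risk M W P drift vol lam \<longleftrightarrow>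
     adapted_on (brownian_filtration M W) {0..} lam \<and>
     (AE w in M. \<forall>t\<ge>0. \<forall>T\<ge>t.
        drift t T w = short_rate P t w * P t T w + vol t T w \<bullet> lam t w)"

definition bond_density :: "(real \<Rightarrow> real \<Rightarrow> 'w \<Rightarrow> real) \<Rightarrow> real \<Rightarrow> real \<Rightarrow> 'w \<Rightarrow> real" where
  "bond_density P t x w = - dx (\<lambda>y. P t (t + y) w) x"

definition density_vol ::
    "(real \<Rightarrow> real \<Rightarrow> 'w \<Rightarrow> 'v::euclidean_space) \<Rightarrow> real \<Rightarrow> real \<Rightarrow> 'w \<Rightarrow> 'v" where
  "density_vol vol t x w = - dx (\<lambda>y. vol t (t + y) w) x"

definition probability_density_on_halfline :: "(real \<Rightarrow> real) \<Rightarrow> bool" where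
  "probability_density_on_halfline f \<longleftrightarrow>
     set_borel_measurable borel {0..} f \<and> (\<forall>x\<ge>0. 0 \<le> f x) \<and>
     (\<integral>\<^sup>+x\<in>{0..}. ennreal (f x) \<partial>lborel) = 1"

end

theory Submission
  imports Defs
begin

text \<open>
  Substituting the no-arbitrage drift \<open>r\<^sub>t P + \<Sigma> \<cdot> \<lambda>\<^sub>t\<close> into the stochastic differential of
  \<open>P\<^bsub>t,t+x\<^esub>\<close> and differentiating it in \<open>x\<close> under the integral signs gives the equation for
  \<open>\<rho>\<close>. Everything else is the fundamental theorem of calculus on the half-line, applied path by
  path to \<open>P\<^bsub>t,t+x\<^esub>\<close>, \<open>\<rho>\<^sub>t(x)\<close> and \<open>\<Sigma>\<^bsub>t,t+x\<^esub>\<close> and using \<open>\<rho>\<^sub>t(0) = r\<^sub>t\<close>; the integrals in the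
  constraints are improper, that is Henstock-Kurzweil, integrals.
\<close>

section \<open>Derivatives on a half-line\<close>

text \<open>Right neighbourhoods of \<open>x\<close> already make the filter nontrivial, so
  derivatives within the half-line are unique even at its end point. This is what allows
  \<open>vector_derivative\<close> and \<open>dx\<close> to be computed.\<close>

lemma at_within_atLeast_neq_bot:
  fixes x :: real
  assumes "a \<le> x"
  shows "at x within {a..} \<noteq> bot"
proof -
  have "at_right x \<le> at x within {a..}"
    using assms by (intro at_le) auto
  then show ?thesis
    by (metis bot.extremum_uniqueI trivial_limit_at_right_real)
qed

lemma dx_eqI:
  assumes "(f has_vector_derivative d) (at x within {0..})" "0 \<le> x"
  shows "dx f x = d"
  unfolding dx_def
  using assms at_within_atLeast_neq_bot[of 0 x] by (intro vector_derivative_within) auto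

lemma smooth_from_has_dx:
  assumes "smooth_from 0 f" "0 \<le> x"
  shows "(f has_vector_derivative dx f x) (at x within {0..})"
proof -
  obtain D where D: "\<forall>T\<ge>0. D 0 T = f T"
    and D': "\<forall>k::nat. \<forall>T\<ge>0. (D k has_vector_derivative D (Suc k) T) (at T within {0..})"
    using assms(1) unfolding smooth_from_def by blast
  \<comment> \<open>The witness \<open>D 0\<close> agrees with \<open>f\<close> only on the
    half-line, so its derivative is transferred within \<open>{0..}\<close>.\<close>
  have "(f has_vector_derivative D (Suc 0) x) (at x within {0..})"
    by (rule has_vector_derivative_transform[of _ _ _ "D 0"]) (use D D' assms(2) in auto)
  then show ?thesis
    using dx_eqI[OF _ assms(2)] by metis
qed

text \<open>The derivatives of \<open>f\<close>, shifted by one index, witness smoothness;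
  uniqueness of derivatives identifies the first of them with \<open>dx f\<close> on the
  half-line.\<close>

lemma smooth_from_dx:
  assumes "smooth_from 0 f"
  shows "smooth_from 0 (dx f)"
proof -
  obtain D where D: "\<forall>T\<ge>0. D 0 T = f T"
    and D': "\<forall>k::nat. \<forall>T\<ge>0. (D k has_vector_derivative D (Suc k) T) (at T within {0..})"
    using assms unfolding smooth_from_def by blast
  have "D (Suc 0) x = dx f x" if "0 \<le> x" for x
  proof -
    have "(f has_vector_derivative D (Suc 0) x) (at x within {0..})"
      by (rule has_vector_derivative_transform[of _ _ _ "D 0"]) (use D D' that in auto)
    then show ?thesis
      using dx_eqI[OF _ that] by metis
  qed
  then show ?thesis
    unfolding smooth_from_def using D' by (intro exI[of _ "\<lambda>k. D (Suc k)"]) auto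
qed

text \<open>Chain rule for the translation by \<open>t\<close>, which maps \<open>{0..}\<close> onto
  \<open>{t..}\<close>. It carries derivatives in the maturity to derivatives in the time to
  maturity.\<close>

lemma has_vector_derivative_shift_atLeast:
  fixes f :: "real \<Rightarrow> 'a::real_normed_vector"
  assumes "(f has_vector_derivative d) (at (t + x) within {t..})"
  shows "((\<lambda>y. f (t + y)) has_vector_derivative d) (at x within {0..})"
proof -
  have "((+) t has_vector_derivative 1) (at x within {0..})"
    by (auto intro!: derivative_eq_intros)
  moreover have "(f has_vector_derivative d) (at (t + x) within (+) t ` {0..})"
    using assms by simp
  ultimately show ?thesis
    using vector_diff_chain_within[of "(+) t" 1 x "{0..}" f d] by (simp add: o_def)
qed

lemma smooth_from_shift:
  assumes "smooth_from t f"
  shows "smooth_from 0 (\<lambda>y. f (t + y))"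
proof -
  obtain D where D: "\<forall>T\<ge>t. D 0 T = f T"
    and D': "\<forall>k::nat. \<forall>T\<ge>t. (D k has_vector_derivative D (Suc k) T) (at T within {t..})"
    using assms unfolding smooth_from_def by blast
  have "((\<lambda>y. D k (t + y)) has_vector_derivative D (Suc k) (t + x)) (at x within {0..})"
    if "0 \<le> x" for k x
    by (rule has_vector_derivative_shift_atLeast) (use D' that in auto)
  then show ?thesis
    unfolding smooth_from_def
    by (intro exI[of _ "\<lambda>k y. D k (t + y)"]) (use D in auto)
qed

text \<open>Needed to translate what is formulated in the maturity: the sign condition of
  admissibility and, at \<open>x = 0\<close>, the short rate.\<close>

lemma vector_derivative_eq_dx_shift:
  assumes "smooth_from t f" "0 \<le> x"
  shows "vector_derivative f (at (t + x) within {t..}) = dx (\<lambda>y. f (t + y)) x"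
proof -
  obtain D where D: "\<forall>T\<ge>t. D 0 T = f T"
    and D': "\<forall>k::nat. \<forall>T\<ge>t. (D k has_vector_derivative D (Suc k) T) (at T within {t..})"
    using assms(1) unfolding smooth_from_def by blast
  have *: "(f has_vector_derivative D (Suc 0) (t + x)) (at (t + x) within {t..})"
    by (rule has_vector_derivative_transform[of _ _ _ "D 0"]) (use D D' assms(2) in auto)
  have "vector_derivative f (at (t + x) within {t..}) = D (Suc 0) (t + x)"
    using * at_within_atLeast_neq_bot[of t "t + x"] assms(2)
    by (intro vector_derivative_within) auto
  moreover have "dx (\<lambda>y. f (t + y)) x = D (Suc 0) (t + x)"
    by (intro dx_eqI has_vector_derivative_shift_atLeast * assms(2))
  ultimately show ?thesis by simp
qed

text \<open>The steps \<open>1 / real (Suc n)\<close> are positive, so the points stay in the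
  half-line even for \<open>x = 0\<close>. Only countably many points occur, which later allows
  exceptional null sets to be united and a derivative to be seen as a limit of measurable
  functions.\<close>

lemma tendsto_difference_quotient:
  fixes f :: "real \<Rightarrow> real"
  assumes "(f has_real_derivative d) (at x within {0..})" "0 \<le> x"
  shows "(\<lambda>n. (f (x + 1 / real (Suc n)) - f x) * real (Suc n)) \<longlonglongrightarrow> d"
proof -
  have "((\<lambda>y. (f y - f x) / (y - x)) \<longlongrightarrow> d) (at x within {0..})"
    using assms(1) by (simp add: has_field_derivative_iff)
  moreover have "filterlim (\<lambda>n. x + 1 / real (Suc n)) (at x within {0..}) sequentially"
    unfolding filterlim_at
  proof
    show "(\<lambda>n. x + 1 / real (Suc n)) \<longlonglongrightarrow> x"
      using tendsto_add[OF tendsto_const[of x] LIMSEQ_inverse_real_of_nat]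
      by (simp add: inverse_eq_divide)
  qed (use assms(2) in \<open>auto intro!: always_eventually\<close>)
  ultimately have "(\<lambda>n. (f (x + 1 / real (Suc n)) - f x) / ((x + 1 / real (Suc n)) - x)) \<longlonglongrightarrow> d"
    by (rule filterlim_compose)
  then show ?thesis
    by (simp add: field_simps)
qed

text \<open>The fundamental theorem on \<open>{0..b}\<close> gives \<open>f b - f 0\<close>, and
  then \<open>b\<close> tends to infinity. Since \<open>dx f\<close> may fail to be absolutely
  integrable, the limit is taken over boxes, as in the gauge integral on unbounded sets.\<close>

lemma has_integral_dx_halfline:
  fixes f :: "real \<Rightarrow> 'a::euclidean_space"
  assumes "smooth_from 0 f" "(f \<longlongrightarrow> l) at_top"
  shows "(dx f has_integral (l - f 0)) {0..}"
proof -
  \<comment> \<open>For \<open>a \<le> 0\<close> the value \<open>max 0 a\<close> is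
    \<open>0\<close>; the second branch covers boxes to the left of the half-line, where the
    integrand vanishes.\<close>
  have ftc: "((\<lambda>x. if x \<in> {0..} then dx f x else 0) has_integral
      (if 0 \<le> b then f b - f (max 0 a) else 0)) (cbox a b)" if "a \<le> 0" for a b
  proof (cases "0 \<le> b")
    case True
    have "(dx f has_integral (f b - f 0)) {0..b}"
      using True assms(1)
      by (intro fundamental_theorem_of_calculus)
        (auto intro: has_vector_derivative_within_subset[OF smooth_from_has_dx])
    then have "((\<lambda>x. if x \<in> {0..b} then dx f x else 0) has_integral (f b - f 0)) (cbox a b)"
      using that by (subst has_integral_restrict) auto
    then have "((\<lambda>x. if x \<in> {0..} then dx f x else 0) has_integral (f b - f 0)) (cbox a b)"
      by (rule has_integral_eq[rotated]) auto
    then show ?thesis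
      using True that by (simp add: max_absorb1)
  next
    case False
    then show ?thesis
      by (intro has_integral_is_0[THEN has_integral_eq_rhs]) auto
  qed
  show ?thesis
  proof (subst has_integral_alt', intro conjI allI impI)
    fix a b :: real
    \<comment> \<open>A box may start to the right of \<open>0\<close>, so it is first enlarged
      until \<open>ftc\<close> applies; integrability then passes to the smaller box.\<close>
    have "(\<lambda>x. if x \<in> {0..} then dx f x else 0) integrable_on cbox (min a 0) b"
      using ftc[of "min a 0" b] by (auto simp: integrable_on_def)
    then show "(\<lambda>x. if x \<in> {0..} then dx f x else 0) integrable_on cbox a b"
      unfolding box_real by (rule integrable_subinterval_real) auto
  next
    fix e :: real
    assume "e > 0"
    then obtain N where N: "norm (f b - l) < e" if "N \<le> b" for b
      using assms(2) by (auto simp: tendsto_iff eventually_at_top_linorder dist_norm)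
    show "\<exists>B>0. \<forall>a b. ball 0 B \<subseteq> cbox a b \<longrightarrow>
        norm (integral (cbox a b) (\<lambda>x. if x \<in> {0..} then dx f x else 0) - (l - f 0)) < e"
    \<comment> \<open>The ball of this radius contains \<open>0\<close> and \<open>max 1 N\<close>.
      Hence every box around it has \<open>a \<le> 0\<close> and reaches past \<open>N\<close>,
      where \<open>f\<close> is within \<open>e\<close> of its limit.\<close>
    proof (intro exI[of _ "max 1 N + 1"] conjI allI impI)
      fix a b :: real
      assume sub: "ball 0 (max 1 N + 1) \<subseteq> cbox a b"
      have "max 1 N \<in> cbox a b" "0 \<in> cbox a b"
        by (rule subsetD[OF sub], simp)+
      then have ab: "a \<le> 0" "0 \<le> b" "N \<le> b" by auto
      have "integral (cbox a b) (\<lambda>x. if x \<in> {0..} then dx f x else 0) = f b - f 0"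
        using integral_unique[OF ftc[of a b]] ab by (simp add: max_def)
      then show "norm (integral (cbox a b) (\<lambda>x. if x \<in> {0..} then dx f x else 0) - (l - f 0)) < e"
        using N[of b] ab by simp
    qed simp
  qed
qed

text \<open>The total mass is \<open>f 0\<close> minus the limit of \<open>f\<close>. As
  \<open>- dx f\<close> is nonnegative and continuous on the half-line, its improper integral is
  also its Lebesgue integral.\<close>

lemma probability_density_on_halfline_minus_dx:
  fixes f :: "real \<Rightarrow> real"
  assumes smooth: "smooth_from 0 f" and "f 0 = 1" and neg: "\<And>x. 0 \<le> x \<Longrightarrow> dx f x \<le> 0"
    and "(f \<longlongrightarrow> 0) at_top"
  shows "probability_density_on_halfline (\<lambda>x. - dx f x)"
proof -
  have integral_1: "((\<lambda>x. - dx f x) has_integral 1) {0..}"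
    using has_integral_neg[OF has_integral_dx_halfline[OF smooth assms(4)]] assms(2) by simp
  have cont: "continuous_on {0..} (dx f)"
    using smooth_from_has_dx[OF smooth_from_dx[OF smooth]]
    by (auto simp: continuous_on_eq_continuous_within intro: has_vector_derivative_continuous)
  have meas: "set_borel_measurable borel {0..} (\<lambda>x. - dx f x)"
    unfolding set_borel_measurable_def
    by (intro borel_measurable_continuous_on_indicator continuous_intros cont) auto
  have "(\<integral>\<^sup>+x\<in>{0..}. ennreal (- dx f x) \<partial>lborel) = 1"
  proof -
    have "((\<lambda>x. if x \<in> {0..} then - dx f x else 0) has_integral 1) UNIV"
      using integral_1 by (simp only: has_integral_restrict_UNIV)
    then have "((\<lambda>x. indicator {0..} x *\<^sub>R (- dx f x)) has_integral 1) UNIV"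
      by (rule has_integral_eq[rotated]) (simp add: indicator_def)
    then have "(\<integral>\<^sup>+x. ennreal (indicator {0..} x *\<^sub>R (- dx f x)) \<partial>lborel) = ennreal 1"
      using meas neg unfolding set_borel_measurable_def
      by (intro nn_integral_has_integral_lborel) (auto simp: indicator_def)
    moreover have "ennreal (indicator {0..} x *\<^sub>R (- dx f x)) = ennreal (- dx f x) * indicator {0..} x" for x
      by (simp split: split_indicator)
    ultimately show ?thesis
      by (simp only: ennreal_1)
  qed
  then show ?thesis
    using neg meas unfolding probability_density_on_halfline_def by simp
qed

section \<open>Measurability up to null sets\<close>

lemma space_brownian_filtration [simp]: "space (brownian_filtration M W t) = space M"
  by (simp add: brownian_filtration_def space_measure_of_conv)

lemma null_sets_brownian_filtration:
  assumes "N \<in> null_sets M"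
  shows "N \<in> sets (brownian_filtration M W t)"
proof -
  have "{W s -` B \<inter> space M | s B. 0 \<le> s \<and> s \<le> t \<and> B \<in> sets borel} \<union> null_sets M \<subseteq> Pow (space M)"
    using sets.sets_into_space by (fastforce simp: null_sets_def)
  then show ?thesis
    unfolding brownian_filtration_def
    using assms by (subst sets_measure_of) auto
qed

text \<open>This is where completeness and the null sets in the filtration pay off: every set at
  time \<open>t\<close> may be altered inside a null set.\<close>

lemma measurable_brownian_filtration_AE:
  fixes f g :: "'w \<Rightarrow> 'a::topological_space"
  assumes "complete_measure M" and f: "f \<in> borel_measurable (brownian_filtration M W t)"
    and ae: "AE w in M. f w = g w"
  shows "g \<in> borel_measurable (brownian_filtration M W t)"
proof (rule measurableI)
  let ?F = "brownian_filtration M W t"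
  interpret complete_measure M by fact
  obtain N where N: "N \<in> null_sets M" "{w \<in> space M. f w \<noteq> g w} \<subseteq> N"
    using ae by (rule AE_E3) blast
  fix B :: "'a set"
  assume B: "B \<in> sets borel"
  have "g -` B \<inter> N \<in> null_sets M"
    using N(1) by (rule complete2[rotated]) auto
  \<comment> \<open>Outside \<open>N\<close> the two preimages coincide; the part inside
    \<open>N\<close> is null by completeness.\<close>
  moreover have "g -` B \<inter> space ?F = (f -` B \<inter> space ?F - N) \<union> (g -` B \<inter> N)"
    using N sets.sets_into_space[of N M] by (auto simp: null_sets_def)
  ultimately show "g -` B \<inter> space ?F \<in> sets ?F"
    using measurable_sets[OF f B] null_sets_brownian_filtration[of N M W t, OF N(1)]
      null_sets_brownian_filtration[of "g -` B \<inter> N" M W t]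
    by (metis sets.Diff sets.Un)
qed auto

text \<open>A jointly measurable version of \<open>H\<close> up to indistinguishability is also one
  of \<open>H'\<close>, so only adaptedness needs an argument.\<close>

lemma progressive_on_AE:
  fixes H H' :: "real \<Rightarrow> 'w \<Rightarrow> 'a::topological_space"
  assumes "complete_measure M" and H: "progressive_on M (brownian_filtration M W) I H"
    and ae: "AE w in M. \<forall>t\<in>I. H t w = H' t w"
  shows "progressive_on M (brownian_filtration M W) I H'"
  unfolding progressive_on_def adapted_on_def
proof (intro conjI ballI)
  fix t assume t: "t \<in> I"
  show "H' t \<in> borel_measurable (brownian_filtration M W t)"
  proof (rule measurable_brownian_filtration_AE[OF assms(1)])
    show "H t \<in> borel_measurable (brownian_filtration M W t)"
      using H t unfolding progressive_on_def adapted_on_def by blast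
    show "AE w in M. H t w = H' t w"
      using ae by eventually_elim (use t in blast)
  qed
next
  obtain G where G: "\<forall>t\<in>I. (\<lambda>(s, w). G s w) \<in>
      borel_measurable (restrict_space borel {0..t} \<Otimes>\<^sub>M brownian_filtration M W t)"
    and HG: "AE w in M. \<forall>t\<in>I. H t w = G t w"
    using H unfolding progressive_on_def by blast
  from ae HG have "AE w in M. \<forall>t\<in>I. H' t w = G t w" by eventually_elim metis
  with G show "\<exists>G. (\<forall>t\<in>I. (\<lambda>(s, w). G s w) \<in>
        borel_measurable (restrict_space borel {0..t} \<Otimes>\<^sub>M brownian_filtration M W t)) \<and>
      (AE w in M. \<forall>t\<in>I. H' t w = G t w)"
    by (intro exI[of _ G] conjI)
qed

lemma progressive_on_uminus:
  fixes H :: "real \<Rightarrow> 'w \<Rightarrow> 'a::euclidean_space"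
  assumes "progressive_on M F I H"
  shows "progressive_on M F I (\<lambda>t w. - H t w)"
proof -
  obtain G where G: "\<forall>t\<in>I. (\<lambda>(s, w). G s w) \<in> borel_measurable (restrict_space borel {0..t} \<Otimes>\<^sub>M F t)"
    and ae: "AE w in M. \<forall>t\<in>I. H t w = G t w"
    using assms unfolding progressive_on_def by blast
  have "\<forall>t\<in>I. (\<lambda>(s, w). - G s w) \<in> borel_measurable (restrict_space borel {0..t} \<Otimes>\<^sub>M F t)"
  proof
    fix t assume "t \<in> I"
    then show "(\<lambda>(s, w). - G s w) \<in> borel_measurable (restrict_space borel {0..t} \<Otimes>\<^sub>M F t)"
      using borel_measurable_uminus[OF G[rule_format, of t]] by (simp add: case_prod_beta)
  qed
  moreover have "AE w in M. \<forall>t\<in>I. - H t w = - G t w"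
    using ae by eventually_elim simp
  moreover have "adapted_on F I (\<lambda>t w. - H t w)"
    using assms unfolding progressive_on_def adapted_on_def by auto
  ultimately show ?thesis
    unfolding progressive_on_def by (intro conjI exI[of _ "\<lambda>t w. - G t w"])
qed

section \<open>The negative of an Ito integral\<close>

text \<open>Negating the approximating simple processes leaves the squared distances to the
  integrand unchanged and reverses the sign of the simple integrals.\<close>

lemma has_ito_integral_uminus:
  assumes "has_ito_integral M W I H J"
  shows "has_ito_integral M W I (\<lambda>t w. - H t w) (\<lambda>t w. - J t w)"
proof -
  let ?F = "brownian_filtration M W"
  obtain n \<tau> \<xi> where simple: "\<And>k::nat. simple_integrand M ?F (n k) (\<tau> k) (\<xi> k)"
    and conv: "\<And>t. t \<in> I \<Longrightarrow> converges_in_probability M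
      (\<lambda>k w. LBINT s:{0..t}. (norm (simple_process (n k) (\<tau> k) (\<xi> k) s w - H s w))\<^sup>2) (\<lambda>w. 0)"
    and conv': "\<And>t. t \<in> I \<Longrightarrow> converges_in_probability M
      (\<lambda>k. simple_ito_integral W (n k) (\<tau> k) (\<xi> k) t) (J t)"
    using assms unfolding has_ito_integral_def by blast
  have process: "simple_process m \<sigma> (\<lambda>i w. - \<eta> i w) s w = - simple_process m \<sigma> \<eta> s w"
    for m \<sigma> s w and \<eta> :: "nat \<Rightarrow> 'a \<Rightarrow> 'b"
    by (simp add: simple_process_def sum_negf)
  have ito: "simple_ito_integral W m \<sigma> (\<lambda>i w. - \<eta> i w) t = (\<lambda>w. - simple_ito_integral W m \<sigma> \<eta> t w)"
    for m \<sigma> t \<eta>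
    by (simp add: simple_ito_integral_def sum_negf fun_eq_iff)
  have norm_eq: "norm (- u - - v) = norm (u - v)" for u v :: 'b
    using norm_minus_cancel[of "u - v"] by (simp add: algebra_simps)
  have "simple_integrand M ?F (n k) (\<tau> k) (\<lambda>i w. - \<xi> k i w)" for k
    using simple[of k] unfolding simple_integrand_def by auto
  moreover have "converges_in_probability M
      (\<lambda>k w. LBINT s:{0..t}.
        (norm (simple_process (n k) (\<tau> k) (\<lambda>i w. - \<xi> k i w) s w - - H s w))\<^sup>2) (\<lambda>w. 0)"
    if "t \<in> I" for t
    using conv[OF that] unfolding process norm_eq .
  moreover have "converges_in_probability M
      (\<lambda>k. simple_ito_integral W (n k) (\<tau> k) (\<lambda>i w. - \<xi> k i w) t) (\<lambda>w. - J t w)"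
    if "t \<in> I" for t
  proof -
    have "\<bar>- a - - b\<bar> = \<bar>a - b\<bar>" for a b :: real by simp
    then show ?thesis
      using conv'[OF that] unfolding converges_in_probability_def ito by auto
  qed
  moreover have "AE w in M. continuous_on I (\<lambda>t. - J t w)"
    using assms unfolding has_ito_integral_def by (auto intro: continuous_on_minus)
  moreover have "adapted_on ?F I (\<lambda>t w. - J t w)"
    using assms unfolding has_ito_integral_def adapted_on_def by auto
  moreover have "progressive_on M ?F I (\<lambda>t w. - H t w)"
    using assms unfolding has_ito_integral_def by (auto intro: progressive_on_uminus)
  moreover have "AE w in M. \<forall>t\<in>I. set_integrable lborel {0..t} (\<lambda>s. (norm (- H s w))\<^sup>2)"
    using assms unfolding has_ito_integral_def by simp
  ultimately show ?thesis
    unfolding has_ito_integral_def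
    by (intro conjI exI[of _ n] exI[of _ \<tau>] exI[of _ "\<lambda>k i w. - \<xi> k i w"]) auto
qed

section \<open>Differentiating a stochastic differential in a parameter\<close>

text \<open>The derivative is almost surely a limit of measurable difference quotients. Their
  \<open>lim\<close> is measurable on the whole space, whatever its value where they
  diverge.\<close>

lemma measurable_dx_brownian_filtration:
  fixes X :: "real \<Rightarrow> 'w \<Rightarrow> real"
  assumes "complete_measure M"
    and meas: "\<And>x. 0 \<le> x \<Longrightarrow> X x \<in> borel_measurable (brownian_filtration M W t)"
    and deriv: "AE w in M. ((\<lambda>y. X y w) has_real_derivative dx (\<lambda>y. X y w) x) (at x within {0..})"
    and "0 \<le> x"
  shows "(\<lambda>w. dx (\<lambda>y. X y w) x) \<in> borel_measurable (brownian_filtration M W t)"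
proof (rule measurable_brownian_filtration_AE[OF assms(1)])
  let ?q = "\<lambda>n w. (X (x + 1 / real (Suc n)) w - X x w) * real (Suc n)"
  show "(\<lambda>w. lim (\<lambda>n. ?q n w)) \<in> borel_measurable (brownian_filtration M W t)"
    by (intro borel_measurable_lim_metric borel_measurable_times borel_measurable_diff
        borel_measurable_const meas) (use assms(4) in auto)
  show "AE w in M. lim (\<lambda>n. ?q n w) = dx (\<lambda>y. X y w) x"
    using deriv by eventually_elim (use tendsto_difference_quotient assms(4) in \<open>blast intro: limI\<close>)
qed

text \<open>The integral equation for \<open>X\<close> is differentiated path by path. The
  hypotheses supply derivatives of all its terms, so it remains to see that those of the two sides
  agree.\<close>

lemma differentiable_under_integrals_stochastic_differential:
  assumes complete: "complete_measure M"
    and diff: "differentiable_under_integrals M W X a b"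
    and X: "AE w in M. \<forall>t\<ge>0. \<forall>x\<ge>0.
      ((\<lambda>y. X t y w) has_real_derivative dx (\<lambda>y. X t y w) x) (at x within {0..})"
    and x: "0 \<le> x"
  obtains J' where "ito_decomposition M W {0..} (\<lambda>t w. dx (\<lambda>y. X t y w) x)
      (\<lambda>t w. dx (\<lambda>y. a t y w) x) (\<lambda>t w. dx (\<lambda>y. b t y w) x) J'"
proof -
  let ?F = "brownian_filtration M W"
  have prog: "progressive_on M ?F {0..} (\<lambda>t w. dx (\<lambda>y. a t y w) x)"
    and drift: "AE w in M. \<forall>t\<ge>0. \<forall>x\<ge>0.
        set_integrable lborel {0..t} (\<lambda>s. dx (\<lambda>y. a s y w) x) \<and>
        ((\<lambda>y. LBINT s:{0..t}. a s y w) has_real_derivative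
           (LBINT s:{0..t}. dx (\<lambda>y. a s y w) x)) (at x within {0..})"
    using diff x unfolding differentiable_under_integrals_def by auto
  obtain J J' where decomp: "\<And>x. 0 \<le> x \<Longrightarrow> ito_decomposition M W {0..}
           (\<lambda>t. X t x) (\<lambda>t. a t x) (\<lambda>t. b t x) (\<lambda>t. J t x)"
    and ito: "has_ito_integral M W {0..} (\<lambda>t w. dx (\<lambda>y. b t y w) x) (\<lambda>t. J' t x)"
    and J: "AE w in M. \<forall>t\<ge>0. \<forall>x\<ge>0.
           ((\<lambda>y. J t y w) has_real_derivative J' t x w) (at x within {0..})"
    using diff x unfolding differentiable_under_integrals_def by blast
  have eq: "AE w in M. \<forall>t\<in>{0..}. X t y w = X 0 y w + (LBINT s:{0..t}. a s y w) + J t y w"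
    if "0 \<le> y" for y
    using decomp[OF that] unfolding ito_decomposition_def by auto
  \<comment> \<open>The exceptional null set depends on the parameter, so only countably many parameters can be
    used: those occurring in the difference quotients at \<open>x\<close>.\<close>
  have eq_x: "AE w in M. \<forall>t\<in>{0..}. X t x w = X 0 x w + (LBINT s:{0..t}. a s x w) + J t x w"
    by (rule eq[OF x])
  have eq_seq: "AE w in M. \<forall>n. \<forall>t\<in>{0..}. X t (x + 1 / real (Suc n)) w =
      X 0 (x + 1 / real (Suc n)) w + (LBINT s:{0..t}. a s (x + 1 / real (Suc n)) w)
        + J t (x + 1 / real (Suc n)) w"
    unfolding AE_all_countable using eq x by auto
  have "AE w in M. \<forall>t\<in>{0..}. dx (\<lambda>y. X t y w) x =
      dx (\<lambda>y. X 0 y w) x + (LBINT s:{0..t}. dx (\<lambda>y. a s y w) x) + J' t x w"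
    using eq_x eq_seq X drift J
  proof eventually_elim
    case (elim w)
    show ?case
    proof
      fix t :: real
      assume t: "t \<in> {0..}"
      let ?g = "\<lambda>y. X 0 y w + (LBINT s:{0..t}. a s y w) + J t y w"
      have "(?g has_real_derivative
          dx (\<lambda>y. X 0 y w) x + (LBINT s:{0..t}. dx (\<lambda>y. a s y w) x) + J' t x w) (at x within {0..})"
        using elim(3-5) t x by (intro DERIV_add) auto
      from tendsto_difference_quotient[OF this x]
      have g: "(\<lambda>n. (?g (x + 1 / real (Suc n)) - ?g x) * real (Suc n)) \<longlonglongrightarrow>
        dx (\<lambda>y. X 0 y w) x + (LBINT s:{0..t}. dx (\<lambda>y. a s y w) x) + J' t x w" .
      have "((\<lambda>y. X t y w) has_real_derivative dx (\<lambda>y. X t y w) x) (at x within {0..})"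
        using elim(3) t x by auto
      from tendsto_difference_quotient[OF this x]
      have "(\<lambda>n. (X t (x + 1 / real (Suc n)) w - X t x w) * real (Suc n)) \<longlonglongrightarrow> dx (\<lambda>y. X t y w) x" .
      moreover have "X t (x + 1 / real (Suc n)) w = ?g (x + 1 / real (Suc n))" for n
        using elim(2) t by blast
      moreover have "X t x w = ?g x"
        using elim(1) t by blast
      \<comment> \<open>The quotients of both sides are the same sequence, so their limits, the two
        derivatives, coincide.\<close>
      ultimately have "(\<lambda>n. (?g (x + 1 / real (Suc n)) - ?g x) * real (Suc n)) \<longlonglongrightarrow>
          dx (\<lambda>y. X t y w) x"
        by (simp only:)
      from LIMSEQ_unique[OF this g] show "dx (\<lambda>y. X t y w) x =
        dx (\<lambda>y. X 0 y w) x + (LBINT s:{0..t}. dx (\<lambda>y. a s y w) x) + J' t x w" .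
    qed
  qed
  \<comment> \<open>The initial value of the differentiated process must again be known at time
    \<open>0\<close>.\<close>
  moreover have "(\<lambda>w. dx (\<lambda>y. X 0 y w) x) \<in> borel_measurable (?F 0)"
  proof (rule measurable_dx_brownian_filtration[OF complete _ _ x])
    show "X 0 y \<in> borel_measurable (?F 0)" if "0 \<le> y" for y
      using decomp[OF that] unfolding ito_decomposition_def by auto
    show "AE w in M. ((\<lambda>y. X 0 y w) has_real_derivative dx (\<lambda>y. X 0 y w) x) (at x within {0..})"
      using X x by auto
  qed
  moreover have "AE w in M. \<forall>t\<in>{0..}. set_integrable lborel {0..t} (\<lambda>s. dx (\<lambda>y. a s y w) x)"
    using drift x by auto
  ultimately have "ito_decomposition M W {0..} (\<lambda>t w. dx (\<lambda>y. X t y w) x)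
      (\<lambda>t w. dx (\<lambda>y. a t y w) x) (\<lambda>t w. dx (\<lambda>y. b t y w) x) (\<lambda>t. J' t x)"
    using prog ito unfolding ito_decomposition_def by blast
  then show ?thesis ..
qed

section \<open>Change of sign and of drift in an Ito decomposition\<close>

lemma ito_decomposition_uminus:
  assumes "ito_decomposition M W I X a b J"
  shows "ito_decomposition M W I (\<lambda>t w. - X t w) (\<lambda>t w. - a t w) (\<lambda>t w. - b t w) (\<lambda>t w. - J t w)"
proof -
  have X: "AE w in M. \<forall>t\<in>I. X t w = X 0 w + (LBINT s:{0..t}. a s w) + J t w"
    and a: "AE w in M. \<forall>t\<in>I. set_integrable lborel {0..t} (\<lambda>s. a s w)"
    using assms unfolding ito_decomposition_def by auto
  have "AE w in M. \<forall>t\<in>I. - X t w = - X 0 w + (LBINT s:{0..t}. - a s w) + - J t w"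
    using X by eventually_elim (auto simp: set_lebesgue_integral_def)
  moreover have "AE w in M. \<forall>t\<in>I. set_integrable lborel {0..t} (\<lambda>s. - a s w)"
    using a by eventually_elim (auto simp: set_integrable_def)
  moreover have "(\<lambda>w. - X 0 w) \<in> borel_measurable (brownian_filtration M W 0)"
    using assms unfolding ito_decomposition_def by auto
  moreover have "progressive_on M (brownian_filtration M W) I (\<lambda>t w. - a t w)"
    using assms unfolding ito_decomposition_def by (auto intro: progressive_on_uminus)
  moreover have "has_ito_integral M W I (\<lambda>t w. - b t w) (\<lambda>t w. - J t w)"
    using assms unfolding ito_decomposition_def by (auto intro: has_ito_integral_uminus)
  ultimately show ?thesis
    unfolding ito_decomposition_def by blast
qed

text \<open>Progressive measurability is inherited from the old drift instead of being read off the
  new one. In the application the new drift contains \<open>lam\<close>, which is only assumed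
  adapted.\<close>

lemma ito_decomposition_drift_cong:
  assumes "complete_measure M" "ito_decomposition M W {0..} X a b J"
    and ae: "AE w in M. \<forall>t\<in>{0..}. a t w = a' t w"
  shows "ito_decomposition M W {0..} X a' b J"
proof -
  have X: "AE w in M. \<forall>t\<in>{0..}. X t w = X 0 w + (LBINT s:{0..t}. a s w) + J t w"
    and int: "AE w in M. \<forall>t\<in>{0..}. set_integrable lborel {0..t} (\<lambda>s. a s w)"
    and prog: "progressive_on M (brownian_filtration M W) {0..} a"
    using assms(2) unfolding ito_decomposition_def by blast+
  have int_cong: "set_integrable lborel {0..t} (\<lambda>s. a s w) = set_integrable lborel {0..t} (\<lambda>s. a' s w)"
    "(LBINT s:{0..t}. a s w) = (LBINT s:{0..t}. a' s w)"
    if "\<forall>t\<in>{0..}. a t w = a' t w" for t w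
    using that by (intro set_integrable_cong set_lebesgue_integral_cong; simp)+
  have "AE w in M. \<forall>t\<in>{0..}. X t w = X 0 w + (LBINT s:{0..t}. a' s w) + J t w"
    using ae X
  proof eventually_elim
    case (elim w)
    from elim(2) show ?case
      unfolding int_cong(2)[OF elim(1)] .
  qed
  moreover have "AE w in M. \<forall>t\<in>{0..}. set_integrable lborel {0..t} (\<lambda>s. a' s w)"
    using ae int
  proof eventually_elim
    case (elim w)
    from elim(2) show ?case
      unfolding int_cong(1)[OF elim(1)] .
  qed
  moreover have "progressive_on M (brownian_filtration M W) {0..} a'"
    by (rule progressive_on_AE[OF assms(1) prog ae])
  ultimately show ?thesis
    using assms(2) unfolding ito_decomposition_def by blast
qed

section \<open>Dynamics and constraints of the bond density\<close>

theorem mainTheorem2: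
  fixes M :: "'w measure"
    and W :: "real \<Rightarrow> 'w \<Rightarrow> 'v::euclidean_space"
    and P drift :: "real \<Rightarrow> real \<Rightarrow> 'w \<Rightarrow> real"
    and vol :: "real \<Rightarrow> real \<Rightarrow> 'w \<Rightarrow> 'v"
    and lam :: "real \<Rightarrow> 'w \<Rightarrow> 'v"
    and r :: "real \<Rightarrow> 'w \<Rightarrow> real"
    and \<rho> :: "real \<Rightarrow> real \<Rightarrow> 'w \<Rightarrow> real"
    and \<omega> :: "real \<Rightarrow> real \<Rightarrow> 'w \<Rightarrow> 'v"
  defines "r \<equiv> short_rate P"
    and "\<rho> \<equiv> bond_density P"
    and "\<omega> \<equiv> density_vol vol"
  assumes prob: "prob_space M" and compl: "complete_measure M"
    and brownian: "brownian_motion M W"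
    and dynamics: "bond_dynamics M W P drift vol"
    and adm: "admissible M P"
    and arbitrage_free: "market_price_of_risk M W P drift vol lam"
    and vol_at_maturity: "AE w in M. \<forall>t\<ge>0. vol t t w = 0"
    and vol_infinity: "AE w in M. \<forall>t\<ge>0. ((\<lambda>x. vol t (t + x) w) \<longlongrightarrow> 0) at_top"
    and \<rho>_infinity: "AE w in M. \<forall>t\<ge>0. ((\<lambda>x. \<rho> t x w) \<longlongrightarrow> 0) at_top"
    and forward_semimartingale:
      "\<forall>T\<ge>0. semimartingale_on M (brownian_filtration M W) {0..T} (\<lambda>t. forward_rate P t T)"
    and moving_maturity:
      "\<forall>x\<ge>0. has_stochastic_differential M W {0..}
         (\<lambda>t. P t (t + x))
         (\<lambda>t w. drift t (t + x) w + dx (\<lambda>y. P t (t + y) w) x)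
         (\<lambda>t. vol t (t + x))"
    and differentiation:
      "differentiable_under_integrals M W
         (\<lambda>t x. P t (t + x))
         (\<lambda>t x w. drift t (t + x) w + dx (\<lambda>y. P t (t + y) w) x)
         (\<lambda>t x. vol t (t + x))"
  shows "(AE w in M. \<forall>t\<ge>0. probability_density_on_halfline (\<lambda>x. \<rho> t x w)) \<and>
    (\<forall>x\<ge>0. has_stochastic_differential M W {0..}
       (\<lambda>t. \<rho> t x)
       (\<lambda>t w. r t w * \<rho> t x w + dx (\<lambda>y. \<rho> t y w) x + \<omega> t x w \<bullet> lam t w)
       (\<lambda>t. \<omega> t x)) \<and>
    (AE w in M. \<forall>t\<ge>0.
       (\<lambda>x. dx (\<lambda>y. \<rho> t y w) x) integrable_on {0..} \<and>
       r t w + integral {0..} (\<lambda>x. dx (\<lambda>y. \<rho> t y w) x) = 0 \<and>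
       (\<lambda>x. \<omega> t x w) integrable_on {0..} \<and>
       integral {0..} (\<lambda>x. \<omega> t x w) = 0)"
proof -
  note defs = bond_density_def density_vol_def
  \<comment> \<open>One null set serves all \<open>t\<close>, and everything is rewritten in the
    time to maturity; the last conjunct is \<rho>(0) = r.\<close>
  have P_regular: "AE w in M. \<forall>t\<ge>0. P t t w = 1 \<and> smooth_from 0 (\<lambda>y. P t (t + y) w) \<and>
      (\<forall>x\<ge>0. dx (\<lambda>y. P t (t + y) w) x < 0) \<and> ((\<lambda>y. P t (t + y) w) \<longlongrightarrow> 0) at_top \<and>
      r t w = \<rho> t 0 w"
    using adm unfolding admissible_def
  proof eventually_elim
    case (elim w)
    show ?case
    proof (intro allI impI)
      fix t :: real
      assume "0 \<le> t"
      then have P: "P t t w = 1" "smooth_from t (\<lambda>T. P t T w)"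
        "\<forall>T\<ge>t. vector_derivative (\<lambda>S. P t S w) (at T within {t..}) < 0"
        "((\<lambda>T. P t T w) \<longlongrightarrow> 0) at_top"
        using elim by auto
      note dx_eq = vector_derivative_eq_dx_shift[OF P(2), symmetric]
      have "filterlim (\<lambda>y. t + y) at_top at_top"
        by (rule filterlim_tendsto_add_at_top[OF tendsto_const filterlim_ident])
      then have "((\<lambda>y. P t (t + y) w) \<longlongrightarrow> 0) at_top"
        by (rule filterlim_compose[OF P(4)])
      moreover have "r t w = \<rho> t 0 w"
        unfolding r_def \<rho>_def short_rate_def defs using dx_eq[of 0] by simp
      ultimately show "P t t w = 1 \<and> smooth_from 0 (\<lambda>y. P t (t + y) w) \<and>
          (\<forall>x\<ge>0. dx (\<lambda>y. P t (t + y) w) x < 0) \<and> ((\<lambda>y. P t (t + y) w) \<longlongrightarrow> 0) at_top \<and>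
          r t w = \<rho> t 0 w"
        using P smooth_from_shift[OF P(2)] dx_eq by simp
    qed
  qed
  have vol_smooth: "AE w in M. \<forall>t\<ge>0. smooth_from 0 (\<lambda>y. vol t (t + y) w)"
  proof -
    have "AE w in M. \<forall>t\<ge>0. smooth_from t (\<lambda>T. drift t T w) \<and> smooth_from t (\<lambda>T. vol t T w)"
      using dynamics unfolding bond_dynamics_def by blast
    then show ?thesis
    proof eventually_elim
      case (elim w)
      show ?case
      proof (intro allI impI)
        fix t :: real
        assume "0 \<le> t"
        with elim show "smooth_from 0 (\<lambda>y. vol t (t + y) w)"
          using smooth_from_shift[of t "\<lambda>T. vol t T w"] by simp
      qed
    qed
  qed
  have \<rho>_smooth: "((\<lambda>y. \<rho> t y w) has_vector_derivative - dx (dx (\<lambda>y. P t (t + y) w)) x) (at x within {0..})"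
    if "smooth_from 0 (\<lambda>y. P t (t + y) w)" "0 \<le> x" for t x w
    unfolding \<rho>_def defs
    by (intro has_vector_derivative_minus smooth_from_has_dx smooth_from_dx that)
  have "AE w in M. \<forall>t\<ge>0. probability_density_on_halfline (\<lambda>x. \<rho> t x w)"
    using P_regular
  proof eventually_elim
    case (elim w)
    then show ?case
      unfolding \<rho>_def defs by (auto intro!: probability_density_on_halfline_minus_dx intro: less_imp_le)
  qed
  \<comment> \<open>The drift term with \<open>lam\<close> results from expanding \<omega> . (dW +
    \<lambda> dt).\<close>
  moreover have "has_stochastic_differential M W {0..}
       (\<lambda>t. \<rho> t x)
       (\<lambda>t w. r t w * \<rho> t x w + dx (\<lambda>y. \<rho> t y w) x + \<omega> t x w \<bullet> lam t w)
       (\<lambda>t. \<omega> t x)" if x: "0 \<le> x" for x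
  proof -
    have "AE w in M. \<forall>t\<ge>0. \<forall>x\<ge>0. ((\<lambda>y. P t (t + y) w) has_real_derivative
        dx (\<lambda>y. P t (t + y) w) x) (at x within {0..})"
      using P_regular
      by eventually_elim
        (auto simp: has_real_derivative_iff_has_vector_derivative intro: smooth_from_has_dx)
    \<comment> \<open>The inner \<open>y\<close> is bound anew and the inner \<open>dx\<close> is
      evaluated at the outer \<open>y\<close>, so the moving maturity contributes the second
      derivative of the bond curve, which becomes the term \<partial>\<rho> in the drift.\<close>
    then obtain J' where "ito_decomposition M W {0..} (\<lambda>t w. dx (\<lambda>y. P t (t + y) w) x)
        (\<lambda>t w. dx (\<lambda>y. drift t (t + y) w + dx (\<lambda>y. P t (t + y) w) y) x)
        (\<lambda>t w. dx (\<lambda>y. vol t (t + y) w) x) J'"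
      using differentiable_under_integrals_stochastic_differential[OF compl differentiation _ x]
      by blast
    then have "ito_decomposition M W {0..} (\<lambda>t. \<rho> t x)
        (\<lambda>t w. - dx (\<lambda>y. drift t (t + y) w + dx (\<lambda>y. P t (t + y) w) y) x)
        (\<lambda>t. \<omega> t x) (\<lambda>t w. - J' t w)"
      unfolding \<rho>_def \<omega>_def defs by (rule ito_decomposition_uminus)
    moreover have "AE w in M. \<forall>t\<ge>0. \<forall>T\<ge>t. drift t T w = r t w * P t T w + vol t T w \<bullet> lam t w"
      using arbitrage_free unfolding market_price_of_risk_def r_def by simp
    then have "AE w in M. \<forall>t\<in>{0..}. - dx (\<lambda>y. drift t (t + y) w + dx (\<lambda>y. P t (t + y) w) y) x =
        r t w * \<rho> t x w + dx (\<lambda>y. \<rho> t y w) x + \<omega> t x w \<bullet> lam t w"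
      using P_regular vol_smooth
    proof eventually_elim
      case (elim w)
      show ?case
      proof
        fix t :: real
        assume t: "t \<in> {0..}"
        let ?P = "\<lambda>y. P t (t + y) w" and ?V = "\<lambda>y. vol t (t + y) w"
        have P: "smooth_from 0 ?P" and V: "smooth_from 0 ?V"
          using elim t by auto
        \<comment> \<open>Neither \<open>r t w\<close> nor \<open>lam t w\<close> depends on the
          maturity, so both are constants in this differentiation.\<close>
        have "((\<lambda>y. r t w * ?P y + ?V y \<bullet> lam t w + dx ?P y) has_vector_derivative
            r t w * dx ?P x + dx ?V x \<bullet> lam t w + dx (dx ?P) x) (at x within {0..})"
          by (intro has_vector_derivative_add has_vector_derivative_mult_right
              bounded_linear.has_vector_derivative[OF bounded_linear_inner_left]
              smooth_from_has_dx smooth_from_dx P V x)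
        then have "((\<lambda>y. drift t (t + y) w + dx ?P y) has_vector_derivative
            r t w * dx ?P x + dx ?V x \<bullet> lam t w + dx (dx ?P) x) (at x within {0..})"
          by (rule has_vector_derivative_transform[rotated 2]) (use elim(1) t x in auto)
        then have "dx (\<lambda>y. drift t (t + y) w + dx ?P y) x =
            r t w * dx ?P x + dx ?V x \<bullet> lam t w + dx (dx ?P) x"
          using x by (rule dx_eqI)
        moreover have "dx (\<lambda>y. \<rho> t y w) x = - dx (dx ?P) x"
          using \<rho>_smooth[OF P x] x by (rule dx_eqI)
        ultimately show "- dx (\<lambda>y. drift t (t + y) w + dx ?P y) x =
            r t w * \<rho> t x w + dx (\<lambda>y. \<rho> t y w) x + \<omega> t x w \<bullet> lam t w"
          by (simp add: \<rho>_def \<omega>_def defs)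
      qed
    qed
    ultimately show ?thesis
      unfolding has_stochastic_differential_def
      by (blast intro: ito_decomposition_drift_cong[OF compl])
  qed
  moreover have "AE w in M. \<forall>t\<ge>0.
       (\<lambda>x. dx (\<lambda>y. \<rho> t y w) x) integrable_on {0..} \<and>
       r t w + integral {0..} (\<lambda>x. dx (\<lambda>y. \<rho> t y w) x) = 0 \<and>
       (\<lambda>x. \<omega> t x w) integrable_on {0..} \<and>
       integral {0..} (\<lambda>x. \<omega> t x w) = 0"
    using P_regular vol_smooth vol_at_maturity vol_infinity \<rho>_infinity
  proof eventually_elim
    case (elim w)
    show ?case
    proof (intro allI impI)
      fix t :: real
      assume t: "0 \<le> t"
      let ?P = "\<lambda>y. P t (t + y) w" and ?V = "\<lambda>y. vol t (t + y) w"
      have P: "smooth_from 0 ?P" and V: "smooth_from 0 ?V"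
        using elim t by auto
      have "((\<lambda>x. dx ?P x) \<longlongrightarrow> 0) at_top"
        using elim(5) t tendsto_minus_cancel_left[of "dx ?P" 0] unfolding \<rho>_def defs by simp
      \<comment> \<open>The half-line theorem is applied to \<open>dx ?P\<close>, whose limit is
        \<open>0\<close> because \<rho> vanishes at infinity and whose value at \<open>0\<close> is
        \<open>- r t w\<close>.\<close>
      then have "((\<lambda>x. - dx (dx ?P) x) has_integral - (0 - dx ?P 0)) {0..}"
        by (intro has_integral_neg has_integral_dx_halfline smooth_from_dx P)
      moreover have "- dx (dx ?P) x = dx (\<lambda>y. \<rho> t y w) x" if "x \<in> {0..}" for x
        using dx_eqI[OF \<rho>_smooth[OF P]] that by simp
      ultimately have "((\<lambda>x. dx (\<lambda>y. \<rho> t y w) x) has_integral - (0 - dx ?P 0)) {0..}"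
        by (rule has_integral_eq[rotated])
      moreover have "r t w = - dx ?P 0"
        using elim(1) t unfolding \<rho>_def defs by simp
      \<comment> \<open>Both boundary terms vanish: the volatility tends to \<open>0\<close> at
        infinity and is \<open>0\<close> at maturity.\<close>
      moreover have "((\<lambda>x. \<omega> t x w) has_integral - (0 - ?V 0)) {0..}"
        unfolding \<omega>_def defs using elim(4) t
        by (intro has_integral_neg has_integral_dx_halfline V) auto
      moreover have "?V 0 = 0"
        using elim(3) t by simp
      ultimately show "(\<lambda>x. dx (\<lambda>y. \<rho> t y w) x) integrable_on {0..} \<and>
          r t w + integral {0..} (\<lambda>x. dx (\<lambda>y. \<rho> t y w) x) = 0 \<and>
          (\<lambda>x. \<omega> t x w) integrable_on {0..} \<and> integral {0..} (\<lambda>x. \<omega> t x w) = 0"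
        by (auto simp: integrable_on_def dest: integral_unique)
    qed
  qed
  ultimately show ?thesis
    by blast
qed

end
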